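(* Let $L\in\mathbb R^{N\times N}$ be the graph Laplacian of a weighted directed graph on $N$ vertices, let $n\ge 1$, and let $p_1,\dots,p_n$ be real numbers with $p_k>0$ for all $k=1,\dots,n$ and $p_i\neq p_j$ for all $i\neq j$. Consider the $n$th-order serial consensus system, expressed in the Laplace domain as $$\left(\prod_{k=1}^n (sI+p_kL)\right)X(s)=U(s),$$ with $U(s)=0$, i.e. the initial value problem in the time domain $$x^{(n)}(t)=-\sum_{k=0}^{n-1}a_k L^{n-k}x^{(k)}(t),\qquad t\ge 0,\quad x(t)\in\mathbb R^N,$$ with arbitrary initial conditions, where the coefficients $a_k$ are defined by $\prod_{k=1}^n(s+p_k)=\sum_{k=0}^n a_k s^k$. Define the state $$\xi(t)=\left[(L^{n-1}x)^\top,\ (L^{n-2}\dot x)^\top,\ (L^{n-3}\ddot x)^\top,\ \dots,\ (x^{(n-1)})^\top\right]^\top\in\mathbb R^{nN}.$$ Then $$\sup_{t\ge 0}\|\xi(t)\|_\infty\le \|S\|_\infty\,\|S^{-1}\|_\infty\,\|\xi(0)\|_\infty,$$ where $S$ is any invertible $n\times n$ matrix that diagonalizes (i.e. $S^{-1}AS$ is diagonal) the companion matrix $$A=\begin{bmatrix}0&1& & \\ & &\ddots& \\ & & &1\\ -a_0&-a_1&\cdots&-a_{n-1}\end{bmatrix}\in\mathbb R^{n\times n}.$$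
   Context: Graph Laplacian: a weighted directed graph on $N$ vertices with edge set $\mathcal E\subset\mathcal V\times\mathcal V$ is represented by its weighted adjacency matrix $W\in\mathbb R^{N\times N}$, which has nonnegative entries with $w_{ij}>0$ if and only if $(j,i)\in\mathcal E$ (and $w_{ij}=0$ otherwise). Its graph Laplacian is $L=D-W$ with $D=\mathrm{diag}(W\mathbf 1)$, where $\mathbf 1$ is the all-ones vector. The graph need not be undirected ($W$ need not be symmetric). Norms: for a vector $x$, $\|x\|_\infty=\max_i|x_i|$; for a matrix $C\in\mathbb C^{M\times N}$, $\|C\|_\infty$ denotes the induced norm $\|C\|_\infty=\sup_{\|x\|_\infty=1}\|Cx\|_\infty=\max_i\sum_{j=1}^N|C_{ij}|$. *)

theory Defs
  imports "HOL-Analysis.Analysis" "Jordan_Normal_Form.Matrix"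
begin

no_notation vec_nth (infixl "$" 90)
hide_const (open) Finite_Cartesian_Product.vec Finite_Cartesian_Product.mat

text \<open>Vertices are \<open>0, \<dots>, N - 1\<close>. Self-loops are allowed; an edge \<open>(j, i)\<close> carries the
  weight in row \<open>i\<close>, column \<open>j\<close>.\<close>

definition weighted_adjacency_matrix :: "nat \<Rightarrow> (nat \<times> nat) set \<Rightarrow> real mat \<Rightarrow> bool" where
  "weighted_adjacency_matrix N E W \<longleftrightarrow>
     E \<subseteq> {..<N} \<times> {..<N} \<and> W \<in> carrier_mat N N \<and>
     (\<forall>i<N. \<forall>j<N. W $$ (i, j) \<ge> 0 \<and> (W $$ (i, j) > 0 \<longleftrightarrow> (j, i) \<in> E))"

definition graph_laplacian :: "real mat \<Rightarrow> real mat" where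
  "graph_laplacian W =
     mat_diag (dim_row W) (\<lambda>i. (W *\<^sub>v vec (dim_col W) (\<lambda>_. 1)) $ i) - W"

text \<open>The inserted \<open>0\<close> only matters for the empty vector, whose norm is thereby \<open>0\<close>.\<close>

definition vec_norm_inf :: "'a::real_normed_vector vec \<Rightarrow> real" where
  "vec_norm_inf v = Max (insert 0 {norm (v $ i) | i. i < dim_vec v})"

definition mat_norm_inf :: "complex mat \<Rightarrow> real" where
  "mat_norm_inf C =
     (SUP v \<in> {v \<in> carrier_vec (dim_col C). vec_norm_inf v = 1}. vec_norm_inf (C *\<^sub>v v))"

text \<open>One-sided at \<open>t = 0\<close>; meaningful only where the lower derivatives are differentiable.\<close>

primrec nth_deriv :: "nat \<Rightarrow> (real \<Rightarrow> real) \<Rightarrow> real \<Rightarrow> real" where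
  "nth_deriv 0 f = f"
| "nth_deriv (Suc k) f = (\<lambda>t. vector_derivative (nth_deriv k f) (at t within {0..}))"

definition vec_nth_deriv :: "nat \<Rightarrow> (real \<Rightarrow> real vec) \<Rightarrow> real \<Rightarrow> real vec" where
  "vec_nth_deriv k x t = vec (dim_vec (x t)) (\<lambda>i. nth_deriv k (\<lambda>s. x s $ i) t)"

definition serial_coeff :: "nat \<Rightarrow> (nat \<Rightarrow> real) \<Rightarrow> nat \<Rightarrow> real" where
  "serial_coeff n p k = coeff (\<Prod>i=1..n. [:p i, 1:]) k"

definition serial_consensus_solution ::
  "nat \<Rightarrow> nat \<Rightarrow> real mat \<Rightarrow> (nat \<Rightarrow> real) \<Rightarrow> (real \<Rightarrow> real vec) \<Rightarrow> bool" where
  "serial_consensus_solution N n L p x \<longleftrightarrow>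
     (\<forall>t\<ge>0. x t \<in> carrier_vec N) \<and>
     (\<forall>k<n. \<forall>i<N. \<forall>t\<ge>0. nth_deriv k (\<lambda>s. x s $ i) differentiable (at t within {0..})) \<and>
     (\<forall>t\<ge>0. vec_nth_deriv n x t =
        - finsum_vec TYPE(real) N
            (\<lambda>k. serial_coeff n p k \<cdot>\<^sub>v (L ^\<^sub>m (n - k) *\<^sub>v vec_nth_deriv k x t)) {0..<n})"

definition serial_state :: "nat \<Rightarrow> real mat \<Rightarrow> (real \<Rightarrow> real vec) \<Rightarrow> real \<Rightarrow> real vec" where
  "serial_state n L x t =
     vec_of_list (concat (map (\<lambda>k. list_of_vec (L ^\<^sub>m (n - 1 - k) *\<^sub>v vec_nth_deriv k x t)) [0..<n]))"

definition companion_matrix :: "nat \<Rightarrow> (nat \<Rightarrow> real) \<Rightarrow> real mat" where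
  "companion_matrix n a =
     mat n n (\<lambda>(i, j). if i = n - 1 then - a j else if j = i + 1 then 1 else 0)"

lemma vec_norm_inf_leI:
  assumes "0 \<le> c" "\<And>i. i < dim_vec v \<Longrightarrow> norm (v $ i) \<le> c"
  shows "vec_norm_inf v \<le> c"
  unfolding vec_norm_inf_def using assms by (subst Max_le_iff) auto

lemma vec_norm_inf_ge: "i < dim_vec v \<Longrightarrow> norm (v $ i) \<le> vec_norm_inf v"
  unfolding vec_norm_inf_def by (intro Max_ge) auto

lemma vec_norm_inf_nonneg: "0 \<le> vec_norm_inf v"
  unfolding vec_norm_inf_def by (intro Max_ge) auto

lemma mat_norm_inf_eq_row_sum:
  assumes C: "C \<in> carrier_mat m n" and "m > 0" "n > 0"
  shows "mat_norm_inf C = Max {\<Sum>j<n. norm (C $$ (i, j)) | i. i < m}"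
proof -
  define R where "R i = (\<Sum>j<n. norm (C $$ (i, j)))" for i
  let ?M = "Max (R ` {..<m})"
  let ?B = "{v \<in> carrier_vec (dim_col C). vec_norm_inf v = 1}"
  have set_eq: "{\<Sum>j<n. norm (C $$ (i, j)) | i. i < m} = R ` {..<m}"
    by (auto simp: R_def)
  have ent: "(C *\<^sub>v v) $ i = (\<Sum>j<n. C $$ (i, j) * v $ j)"
    if "i < m" "v \<in> carrier_vec n" for i v
    using C that by (auto simp: scalar_prod_def atLeast0LessThan intro!: sum.cong)
  have R_le: "R i \<le> ?M" if "i < m" for i
    using that by (intro Max_ge) auto
  have upper: "vec_norm_inf (C *\<^sub>v v) \<le> ?M" if v: "v \<in> ?B" for v
  proof (rule vec_norm_inf_leI)
    have "0 \<le> R 0" by (auto simp: R_def intro: sum_nonneg)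
    with R_le[of 0] \<open>m > 0\<close> show "0 \<le> ?M" by linarith
  next
    fix i assume "i < dim_vec (C *\<^sub>v v)"
    hence i: "i < m" using C by simp
    have vn: "v \<in> carrier_vec n" using v C by auto
    have "norm ((C *\<^sub>v v) $ i) \<le> (\<Sum>j<n. norm (C $$ (i, j) * v $ j))"
      unfolding ent[OF i vn] by (rule norm_sum)
    also have "\<dots> \<le> R i"
      unfolding R_def
    proof (rule sum_mono)
      fix j assume "j \<in> {..<n}"
      hence "norm (v $ j) \<le> 1"
        using vec_norm_inf_ge[of j v] v vn by auto
      thus "norm (C $$ (i, j) * v $ j) \<le> norm (C $$ (i, j))"
        unfolding norm_mult by (intro mult_left_le) auto
    qed
    also have "\<dots> \<le> ?M" by (rule R_le[OF i])
    finally show "norm ((C *\<^sub>v v) $ i) \<le> ?M" .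
  qed
  have "?M \<in> R ` {..<m}" using \<open>m > 0\<close> by (intro Max_in) auto
  then obtain i where i: "i < m" "?M = R i" by auto
  define v where
    "v = vec n (\<lambda>j. if C $$ (i, j) = 0 then 1 else cnj (C $$ (i, j)) / of_real (norm (C $$ (i, j))))"
  have vn: "v \<in> carrier_vec n" by (simp add: v_def)
  have v1: "norm (v $ j) = 1" if "j < n" for j
    using that by (auto simp: v_def norm_divide)
  have "vec_norm_inf v \<le> 1" using v1 vn by (intro vec_norm_inf_leI) auto
  moreover have "1 \<le> vec_norm_inf v"
    using vec_norm_inf_ge[of 0 v] v1[of 0] vn \<open>n > 0\<close> by auto
  ultimately have vB: "v \<in> ?B" using vn C by auto
  have prod: "C $$ (i, j) * v $ j = of_real (norm (C $$ (i, j)))" if "j < n" for j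
    using that by (auto simp: v_def complex_norm_square[symmetric] power2_eq_square)
  have "(C *\<^sub>v v) $ i = of_real (R i)"
    unfolding ent[OF i(1) vn] R_def of_real_sum by (intro sum.cong) (auto simp: prod)
  moreover have "0 \<le> R i" by (auto simp: R_def intro: sum_nonneg)
  ultimately have "R i \<le> vec_norm_inf (C *\<^sub>v v)"
    using vec_norm_inf_ge[of i "C *\<^sub>v v"] i C by auto
  with upper[OF vB] i have att: "vec_norm_inf (C *\<^sub>v v) = ?M" by simp
  show ?thesis
    unfolding set_eq mat_norm_inf_def
  proof (rule cSup_eq_maximum)
    show "?M \<in> (\<lambda>v. vec_norm_inf (C *\<^sub>v v)) ` ?B" using vB att by (intro image_eqI[of _ _ v]) auto
  qed (use upper in auto)
qed

end

theory Submission
  imports Defs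
begin

text \<open>The state satisfies \<open>\<xi>' = (A \<otimes> L) \<xi>\<close>, so \<open>\<eta> = (S\<inverse> \<otimes> I) \<xi>\<close> decouples into first-order consensus
  systems \<open>\<eta>\<^sub>m' = - q\<^sub>m L \<eta>\<^sub>m\<close>, where \<open>- q\<^sub>m\<close> is an eigenvalue of \<open>A\<close> and hence one of the \<open>- p\<^sub>k < 0\<close>.
  A maximum principle bounds each \<open>\<eta>\<^sub>m\<close> by its initial supremum norm, and translating between
  \<open>\<xi>\<close> and \<open>\<eta>\<close> costs the factors \<open>\<parallel>S\<inverse>\<parallel>\<close> and \<open>\<parallel>S\<parallel>\<close>.\<close>

section \<open>Maximum principles for weighted diffusion\<close>

text \<open>A component that is currently largest sees only nonpositive differences, so nonnegative
  weights cannot push it further up. Symmetry of \<open>c\<close> never enters, which is what makes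
  directed graphs admissible.\<close>

lemma diffusion_max_principle_real:
  fixes y :: "'i \<Rightarrow> real \<Rightarrow> real" and c :: "'i \<Rightarrow> 'i \<Rightarrow> real"
  assumes I: "finite I"
    and c: "\<And>i j. i \<in> I \<Longrightarrow> j \<in> I \<Longrightarrow> 0 \<le> c i j"
    and deriv: "\<And>i t. i \<in> I \<Longrightarrow> 0 \<le> t \<Longrightarrow>
      (y i has_real_derivative (\<Sum>j\<in>I. c i j * (y j t - y i t))) (at t within {0..})"
    and init: "\<And>i. i \<in> I \<Longrightarrow> y i 0 \<le> M"
    and i: "i \<in> I" and t: "0 \<le> t"
  shows "y i t \<le> M"
proof (rule ccontr)
  assume "\<not> y i t \<le> M"
  \<comment> \<open>Tilting by a strictly increasing function makes the derivative strictly negative at the first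
    time some component of \<open>u\<close> reaches \<open>0\<close>.\<close>
  define \<epsilon> where "\<epsilon> = (y i t - M) / (1 + t)"
  have \<epsilon>: "0 < \<epsilon>" using \<open>\<not> y i t \<le> M\<close> t by (simp add: \<epsilon>_def)
  define u where "u j s = y j s - M - \<epsilon> * (1 + s)" for j s
  \<comment> \<open>The tilt is common to all components and cancels in the differences; only its
    slope \<open>- \<epsilon>\<close> remains.\<close>
  have u_deriv: "(u j has_real_derivative (\<Sum>k\<in>I. c j k * (u k s - u j s)) - \<epsilon>) (at s within {0..})"
    if "j \<in> I" "0 \<le> s" for j s
    unfolding u_def by (rule derivative_eq_intros deriv that refl)+ simp
  have u_cont: "continuous_on {0..} (u j)" if "j \<in> I" for j
    using u_deriv[OF that] by (auto simp: continuous_on_eq_continuous_within intro!: DERIV_continuous)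
  \<comment> \<open>Times in \<open>{0..t}\<close> at which some component of \<open>u\<close> is
    nonnegative. Compactness yields a first such time \<open>s\<close>.\<close>
  define K where "K = (\<Union>j\<in>I. {0..t} \<inter> u j -` {0..})"
  have "closed ({0..t} \<inter> u j -` {0..})" if "j \<in> I" for j
    by (intro continuous_closed_preimage continuous_on_subset[OF u_cont[OF that]]) auto
  then have "compact ({0..t} \<inter> u j -` {0..})" if "j \<in> I" for j
    using compact_Int_closed[OF compact_Icc[of 0 t], of "{0..t} \<inter> u j -` {0..}"] that
    by (simp add: Int_absorb1)
  then have "compact K"
    unfolding K_def using I by (intro compact_UN) auto
  \<comment> \<open>The value of \<open>\<epsilon>\<close> was chosen for this equation, which makes
    \<open>K\<close> nonempty.\<close>
  moreover have "u i t = 0" using t by (simp add: u_def \<epsilon>_def)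
  then have "t \<in> K" unfolding K_def using i t by (intro UN_I[of i]) auto
  ultimately obtain s where s: "s \<in> K" "\<And>r. r \<in> K \<Longrightarrow> s \<le> r"
    using compact_attains_inf[of K] by blast
  have s_range: "0 \<le> s" "s \<le> t" using s(1) by (auto simp: K_def)
  have "Max ((\<lambda>k. u k s) ` I) \<in> (\<lambda>k. u k s) ` I"
    using I i by (intro Max_in) auto
  then obtain j where "j \<in> I" "Max ((\<lambda>k. u k s) ` I) = u j s" by blast
  moreover have "u k s \<le> Max ((\<lambda>k. u k s) ` I)" if "k \<in> I" for k
    using I that by (intro Max_ge) auto
  ultimately have j: "j \<in> I" "\<And>k. k \<in> I \<Longrightarrow> u k s \<le> u j s" by auto
  have uj: "0 \<le> u j s"
    using s(1) j(2) by (force simp: K_def)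
  have "u j 0 < 0" using init[OF j(1)] \<epsilon> by (simp add: u_def)
  with uj s_range have "0 < s" by (cases "s = 0") auto
  have "(\<Sum>k\<in>I. c j k * (u k s - u j s)) \<le> 0"
    by (intro sum_nonpos mult_nonneg_nonpos) (use c j in auto)
  then have "(\<Sum>k\<in>I. c j k * (u k s - u j s)) - \<epsilon> < 0" using \<epsilon> by simp
  \<comment> \<open>A negative slope makes \<open>u j\<close> larger just before \<open>s\<close>,
    hence still nonnegative there, against the minimality of \<open>s\<close>. Since
    \<open>0 < s\<close>, there is room to step left inside \<open>{0..}\<close>.\<close>
  from has_real_derivative_neg_dec_left[OF u_deriv[OF j(1) s_range(1)] this]
  obtain d where d: "0 < d" "\<And>h. 0 < h \<Longrightarrow> s - h \<in> {0..} \<Longrightarrow> h < d \<Longrightarrow> u j s < u j (s - h)"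
    by blast
  define h where "h = min (d / 2) s"
  have h: "0 < h" "h < d" "0 \<le> s - h" using d(1) \<open>0 < s\<close> by (auto simp: h_def)
  then have "s - h \<in> K"
    unfolding K_def using d(2)[of h] uj j(1) s_range by (intro UN_I[of j]) auto
  then show False using s(2) h(1) by fastforce
qed

text \<open>The decoupled variables are complex because \<open>S\<close> may be: even for real
  eigenvalues, its columns can be scaled by any nonzero complex numbers.\<close>

lemma diffusion_max_principle_complex:
  fixes z :: "'i \<Rightarrow> real \<Rightarrow> complex" and c :: "'i \<Rightarrow> 'i \<Rightarrow> real"
  assumes I: "finite I"
    and c: "\<And>i j. i \<in> I \<Longrightarrow> j \<in> I \<Longrightarrow> 0 \<le> c i j"
    and deriv: "\<And>i t. i \<in> I \<Longrightarrow> 0 \<le> t \<Longrightarrow>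
      (z i has_vector_derivative (\<Sum>j\<in>I. c i j *\<^sub>R (z j t - z i t))) (at t within {0..})"
    and init: "\<And>i. i \<in> I \<Longrightarrow> norm (z i 0) \<le> M"
    and i: "i \<in> I" and t: "0 \<le> t"
  shows "norm (z i t) \<le> M"
proof -
  \<comment> \<open>Rotating by the phase of \<open>z i t\<close> reduces to the real case.\<close>
  define w where "w = cnj (sgn (z i t))"
  \<comment> \<open>Only an inequality, since \<open>w = 0\<close> if
    \<open>z i t = 0\<close>.\<close>
  have w: "norm w \<le> 1" by (simp add: w_def norm_sgn)
  have bl: "bounded_linear (\<lambda>v. Re (w * v))"
    by (intro bounded_linear_compose[OF bounded_linear_Re] bounded_linear_mult_right)
  have "Re (w * z i t) \<le> M"
  proof (rule diffusion_max_principle_real[where y = "\<lambda>j s. Re (w * z j s)" and I = I and c = c])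
    fix j s assume js: "j \<in> I" "(0::real) \<le> s"
    from bounded_linear.has_vector_derivative[OF bl deriv[OF this]]
    show "((\<lambda>s. Re (w * z j s)) has_real_derivative
        (\<Sum>k\<in>I. c j k * (Re (w * z k s) - Re (w * z j s)))) (at s within {0..})"
      unfolding has_real_derivative_iff_has_vector_derivative
      by (rule has_vector_derivative_eq_rhs)
        (auto simp add: linear_sum[OF bounded_linear.linear[OF bl]] algebra_simps
          simp del: times_complex.simps intro!: sum.cong)
  next
    fix j assume "j \<in> I"
    have "Re (w * z j 0) \<le> norm (w * z j 0)" by (rule complex_Re_le_cmod)
    also have "\<dots> \<le> norm (z j 0)" using w by (simp add: norm_mult mult_left_le_one_le)
    also have "\<dots> \<le> M" by (rule init[OF \<open>j \<in> I\<close>])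
    finally show "Re (w * z j 0) \<le> M" .
  qed (use I c i t in auto)
  moreover have "w * z i t = of_real (norm (z i t))"
    by (auto simp: w_def sgn_eq complex_norm_square[symmetric] mult.commute power2_eq_square)
  ultimately show ?thesis by simp
qed

section \<open>Eigenvalues of the companion matrix\<close>

text \<open>All rows but the last force \<open>v\<close> to be the geometric sequence
  \<open>l ^ k * v 0\<close>. Hence \<open>v 0\<close> is nonzero and can be cancelled from the last
  row, which leaves the characteristic equation.\<close>

lemma companion_eigenvector_root:
  fixes a :: "nat \<Rightarrow> real" and v :: "nat \<Rightarrow> complex" and l :: complex
  assumes n: "1 \<le> n"
    and eig: "\<And>k. k < n \<Longrightarrow>
      (\<Sum>j<n. of_real (companion_matrix n a $$ (k, j)) * v j) = l * v k"
    and nz: "\<exists>k<n. v k \<noteq> 0"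
  shows "(\<Sum>j<n. of_real (a j) * l ^ j) + l ^ n = 0"
proof -
  have step: "v (Suc k) = l * v k" if "Suc k < n" for k
  proof -
    have "(\<Sum>j<n. complex_of_real (companion_matrix n a $$ (k, j)) * v j) =
        (\<Sum>j<n. if j = Suc k then v j else 0)"
      using that by (intro sum.cong) (auto simp: companion_matrix_def)
    then show ?thesis using eig[of k] that by simp
  qed
  define b where "b = v 0"
  have v: "v k = l ^ k * b" if "k < n" for k
    using that by (induction k) (auto simp: step b_def)
  have b: "b \<noteq> 0" using nz v by auto
  have "(\<Sum>j<n. complex_of_real (companion_matrix n a $$ (n - 1, j)) * v j) =
      - (\<Sum>j<n. of_real (a j) * l ^ j) * b"
    unfolding sum_negf[symmetric] sum_distrib_right
    using n by (intro sum.cong) (auto simp: companion_matrix_def v)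
  moreover have "l * v (n - 1) = l ^ n * b"
    using n v[of "n - 1"] by (cases n) auto
  ultimately have "- (\<Sum>j<n. of_real (a j) * l ^ j) * b = l ^ n * b"
    using eig[of "n - 1"] n by simp
  then have "((\<Sum>j<n. of_real (a j) * l ^ j) + l ^ n) * b = 0"
    by (metis add.right_inverse distrib_right mult_minus_left)
  then show ?thesis using b by simp
qed

text \<open>The product is monic of degree \<open>n\<close>, so the separate term
  \<open>l ^ n\<close> is its leading term. The factored side shows that every root is some
  \<open>- p i\<close>.\<close>

lemma serial_coeff_sum:
  fixes l :: complex
  shows "(\<Sum>j<n. of_real (serial_coeff n p j) * l ^ j) + l ^ n = (\<Prod>i=1..n. of_real (p i) + l)"
proof -
  define P where "P = (\<Prod>i=1..n. [:p i, 1:])"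
  have deg: "degree P = n"
    unfolding P_def by (subst degree_prod_eq_sum_degree) auto
  have "lead_coeff P = 1"
    unfolding P_def by (subst lead_coeff_prod) simp
  then have top: "coeff P n = 1" by (simp add: deg)
  have "poly (map_poly complex_of_real P) l = (\<Sum>j\<le>n. of_real (coeff P j) * l ^ j)"
    by (simp add: poly_altdef degree_map_poly deg coeff_map_poly)
  also have "\<dots> = (\<Sum>j<n. of_real (coeff P j) * l ^ j) + l ^ n"
    by (simp add: lessThan_Suc_atMost[symmetric] top)
  finally have "poly (map_poly complex_of_real P) l =
      (\<Sum>j<n. of_real (serial_coeff n p j) * l ^ j) + l ^ n"
    by (simp add: serial_coeff_def P_def)
  moreover have "map_poly complex_of_real P = (\<Prod>i=1..n. [:of_real (p i), 1:])"
    unfolding P_def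
  proof (induction n)
    case (Suc n)
    show ?case
      by (rule poly_eqI)
        (simp add: Suc.IH[symmetric, simplified] coeff_map_poly coeff_pCons split: nat.split)
  qed simp
  ultimately show ?thesis by (simp add: poly_prod)
qed

section \<open>Laplacian action, matrix powers and row bounds\<close>

lemma graph_laplacian_carrier: "W \<in> carrier_mat N N \<Longrightarrow> graph_laplacian W \<in> carrier_mat N N"
  unfolding graph_laplacian_def by (rule minus_carrier_mat)

text \<open>The rows of a Laplacian sum to zero, so only differences survive. Up to sign this is the
  form that the maximum principle expects.\<close>

lemma graph_laplacian_mult_vec_index:
  assumes W: "W \<in> carrier_mat N N" and v: "v \<in> carrier_vec N" and i: "i < N"
  shows "(graph_laplacian W *\<^sub>v v) $ i = (\<Sum>j<N. W $$ (i, j) * (v $ i - v $ j))"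
proof -
  have "(graph_laplacian W *\<^sub>v v) $ i =
      (\<Sum>j<N. (if i = j then \<Sum>k<N. W $$ (i, k) else 0) * v $ j - W $$ (i, j) * v $ j)"
    using W v i
    by (auto simp: graph_laplacian_def scalar_prod_def mat_diag_def atLeast0LessThan left_diff_distrib
        intro!: sum.cong)
  also have "\<dots> = (\<Sum>k<N. W $$ (i, k)) * v $ i - (\<Sum>j<N. W $$ (i, j) * v $ j)"
    using i by (simp add: sum_subtractf if_distrib[of "\<lambda>a. a * _"] cong: if_cong)
  finally show ?thesis
    by (simp add: sum_distrib_right right_diff_distrib sum_subtractf)
qed

text \<open>The recursion of \<open>^\<^sub>m\<close> puts the new factor on the right, whereas
  applying \<open>L\<close> to a block puts it on the left.\<close>

lemma pow_mat_mult_vec_Suc: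
  fixes A :: "'a :: comm_semiring_1 mat"
  assumes A: "A \<in> carrier_mat N N" and v: "v \<in> carrier_vec N"
  shows "A ^\<^sub>m Suc k *\<^sub>v v = A *\<^sub>v (A ^\<^sub>m k *\<^sub>v v)"
proof -
  have "A ^\<^sub>m Suc k = A * A ^\<^sub>m k"
  proof (induction k)
    case (Suc k)
    have "A ^\<^sub>m Suc (Suc k) = (A * A ^\<^sub>m k) * A"
      using Suc by simp
    also have "\<dots> = A * (A ^\<^sub>m k * A)"
      by (rule assoc_mult_mat) (use A in auto)
    finally show ?case by simp
  qed (use A in auto)
  then show ?thesis using A v by (simp add: assoc_mult_mat_vec[of A N N "A ^\<^sub>m k" N])
qed

lemma row_sum_le_mat_norm_inf:
  assumes "C \<in> carrier_mat m n" "i < m" "0 < n"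
  shows "(\<Sum>j<n. norm (C $$ (i, j))) \<le> mat_norm_inf C"
  unfolding mat_norm_inf_eq_row_sum[OF assms(1) le_less_trans[OF le0 assms(2)] assms(3)]
  using assms(2) by (intro Max_ge) auto

text \<open>With the vertex fixed, \<open>C \<otimes> I\<close> acts on the block index through
  \<open>C\<close> alone. This bound therefore replaces any norm of a Kronecker product.\<close>

lemma mult_mat_row_norm_le:
  assumes C: "C \<in> carrier_mat m n" "i < m" "0 < n"
    and z: "\<And>j. j < n \<Longrightarrow> norm (z j) \<le> B"
  shows "norm (\<Sum>j<n. C $$ (i, j) * z j) \<le> mat_norm_inf C * B"
proof -
  have B: "0 \<le> B" using z[of 0] C(3) norm_ge_zero order_trans by blast
  have "norm (\<Sum>j<n. C $$ (i, j) * z j) \<le> (\<Sum>j<n. norm (C $$ (i, j)) * B)"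
    by (rule sum_norm_le) (auto simp: norm_mult intro!: mult_left_mono z)
  also have "\<dots> \<le> mat_norm_inf C * B"
    unfolding sum_distrib_right[symmetric]
    by (intro mult_right_mono row_sum_le_mat_norm_inf[OF C] B)
  finally show ?thesis .
qed

section \<open>Blocks of the state and their dynamics\<close>

definition serial_block :: "nat \<Rightarrow> real mat \<Rightarrow> (real \<Rightarrow> real vec) \<Rightarrow> nat \<Rightarrow> real \<Rightarrow> real vec" where
  "serial_block n L x k t = L ^\<^sub>m (n - 1 - k) *\<^sub>v vec_nth_deriv k x t"

lemma serial_block_carrier:
  "L \<in> carrier_mat N N \<Longrightarrow> serial_block n L x k t \<in> carrier_vec N"
  by (rule carrier_vecI) (simp add: serial_block_def)

text \<open>The supremum norm depends only on the set of entries, so comparing sets avoids index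
  arithmetic in the concatenated vector.\<close>

lemma set_serial_state:
  assumes "L \<in> carrier_mat N N"
  shows "{serial_state n L x t $ j | j. j < dim_vec (serial_state n L x t)} =
    {serial_block n L x k t $ i | k i. k < n \<and> i < N}"
proof -
  have set_vec: "set (list_of_vec v) = {v $ i | i. i < dim_vec v}" for v :: "real vec"
    by (auto simp: set_conv_nth list_of_vec_index)
  have "{serial_state n L x t $ j | j. j < dim_vec (serial_state n L x t)} =
      set (concat (map (\<lambda>k. list_of_vec (serial_block n L x k t)) [0..<n]))"
    unfolding serial_state_def serial_block_def set_conv_nth
    by (auto simp: vec_of_list_index)
  also have "\<dots> = {serial_block n L x k t $ i | k i. k < n \<and> i < N}"
    using carrier_vecD[OF serial_block_carrier[OF assms, of n x _ t]] by (force simp: set_vec)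
  finally show ?thesis .
qed

lemma vec_norm_inf_serial_state_leI:
  assumes L: "L \<in> carrier_mat N N" and "0 \<le> B"
    and le: "\<And>k i. k < n \<Longrightarrow> i < N \<Longrightarrow> \<bar>serial_block n L x k t $ i\<bar> \<le> B"
  shows "vec_norm_inf (serial_state n L x t) \<le> B"
proof (rule vec_norm_inf_leI)
  fix j assume "j < dim_vec (serial_state n L x t)"
  then have "serial_state n L x t $ j \<in> {serial_block n L x k t $ i | k i. k < n \<and> i < N}"
    unfolding set_serial_state[OF L, symmetric] by blast
  then show "norm (serial_state n L x t $ j) \<le> B" using le by auto
qed fact

lemma serial_block_le_vec_norm_inf:
  assumes L: "L \<in> carrier_mat N N" and "k < n" "i < N"
  shows "\<bar>serial_block n L x k t $ i\<bar> \<le> vec_norm_inf (serial_state n L x t)"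
proof -
  have "serial_block n L x k t $ i \<in> {serial_block n L x k t $ i | k i. k < n \<and> i < N}"
    using assms by blast
  then have "serial_block n L x k t $ i \<in>
      {serial_state n L x t $ j | j. j < dim_vec (serial_state n L x t)}"
    by (simp only: set_serial_state[OF L])
  then show ?thesis using vec_norm_inf_ge[of _ "serial_state n L x t"] by force
qed

text \<open>The block form of \<open>\<xi>' = (A \<otimes> L) \<xi>\<close>.\<close>

lemma serial_block_deriv:
  assumes L: "L \<in> carrier_mat N N" and n: "1 \<le> n"
    and solution: "serial_consensus_solution N n L p x"
    and k: "k < n" and i: "i < N" and t: "0 \<le> t"
  shows "((\<lambda>t. serial_block n L x k t $ i) has_real_derivative
      (\<Sum>j<n. companion_matrix n (serial_coeff n p) $$ (k, j) * (L *\<^sub>v serial_block n L x j t) $ i))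
      (at t within {0..})"
proof -
  have dims: "\<forall>t\<ge>0. x t \<in> carrier_vec N"
    and diff: "\<forall>k<n. \<forall>i<N. \<forall>t\<ge>0. nth_deriv k (\<lambda>s. x s $ i) differentiable (at t within {0..})"
    and ode: "\<forall>t\<ge>0. vec_nth_deriv n x t =
      - finsum_vec TYPE(real) N
          (\<lambda>j. serial_coeff n p j \<cdot>\<^sub>v (L ^\<^sub>m (n - j) *\<^sub>v vec_nth_deriv j x t)) {0..<n}"
    using solution unfolding serial_consensus_solution_def by blast+
  have dim: "dim_vec (x s) = N" if "0 \<le> s" for s
    using dims that by auto
  have v: "vec_nth_deriv m x s \<in> carrier_vec N" if "0 \<le> s" for m s
    using dim[OF that] by (auto simp: vec_nth_deriv_def)
  \<comment> \<open>Natural-number subtraction is harmless: \<open>j < n\<close> gives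
    \<open>Suc (n - 1 - j) = n - j\<close>.\<close>
  have L_block: "L *\<^sub>v serial_block n L x j t = L ^\<^sub>m (n - j) *\<^sub>v vec_nth_deriv j x t" if "j < n" for j
    using pow_mat_mult_vec_Suc[OF L v[OF t], of "n - 1 - j" j] that
    by (simp add: serial_block_def Suc_diff_Suc)
  have entry: "(L ^\<^sub>m m *\<^sub>v vec_nth_deriv k' x s) $ i =
      (\<Sum>l<N. (L ^\<^sub>m m) $$ (i, l) * nth_deriv k' (\<lambda>s. x s $ l) s)" if "0 \<le> s" for m k' s
    using L i dim[OF that]
    by (auto simp: vec_nth_deriv_def scalar_prod_def atLeast0LessThan intro!: sum.cong)
  have X: "(nth_deriv k (\<lambda>s. x s $ l) has_real_derivative nth_deriv (Suc k) (\<lambda>s. x s $ l) t)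
      (at t within {0..})" if "l < N" for l
    using diff k t that
    by (simp add: has_real_derivative_iff_has_vector_derivative
        vector_derivative_works[symmetric])
  have "((\<lambda>s. \<Sum>l<N. (L ^\<^sub>m (n - 1 - k)) $$ (i, l) * nth_deriv k (\<lambda>s. x s $ l) s) has_real_derivative
      (\<Sum>l<N. (L ^\<^sub>m (n - 1 - k)) $$ (i, l) * nth_deriv (Suc k) (\<lambda>s. x s $ l) t)) (at t within {0..})"
    by (intro DERIV_sum DERIV_cmult X) auto
  \<comment> \<open>The expansion \<open>entry\<close> is available at nonnegative times only, where
    the dimension of \<open>x\<close> is known. This suffices for a derivative within
    \<open>{0..}\<close>.\<close>
  then have "((\<lambda>s. serial_block n L x k s $ i) has_real_derivative
      (L ^\<^sub>m (n - 1 - k) *\<^sub>v vec_nth_deriv (Suc k) x t) $ i) (at t within {0..})"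
    unfolding entry[OF t]
    by (rule has_field_derivative_transform_within[where d = 1])
      (use t in \<open>auto simp: serial_block_def entry\<close>)
  moreover have "(L ^\<^sub>m (n - 1 - k) *\<^sub>v vec_nth_deriv (Suc k) x t) $ i =
      (\<Sum>j<n. companion_matrix n (serial_coeff n p) $$ (k, j) * (L *\<^sub>v serial_block n L x j t) $ i)"
  \<comment> \<open>Above the last row, the single entry 1 selects the next block. In the last row
    the power of \<open>L\<close> is the identity, and the differential equation supplies the
    \<open>n\<close>-th derivative.\<close>
  proof (cases "k = n - 1")
    case False
    then have "(\<Sum>j<n. companion_matrix n (serial_coeff n p) $$ (k, j) * (L *\<^sub>v serial_block n L x j t) $ i) =
        (\<Sum>j<n. if j = Suc k then (L *\<^sub>v serial_block n L x j t) $ i else 0)"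
      using k by (intro sum.cong) (auto simp: companion_matrix_def)
    also have "\<dots> = (L *\<^sub>v serial_block n L x (Suc k) t) $ i" using k False by simp
    finally show ?thesis using L_block[of "Suc k"] k False by simp
  next
    case True
    have closed: "(\<lambda>j. serial_coeff n p j \<cdot>\<^sub>v (L ^\<^sub>m (n - j) *\<^sub>v vec_nth_deriv j x t))
        \<in> {0..<n} \<rightarrow> carrier_vec N"
      using L by (intro Pi_I carrier_vecI) simp
    have "vec_nth_deriv n x t =
        - finsum_vec TYPE(real) N
            (\<lambda>j. serial_coeff n p j \<cdot>\<^sub>v (L ^\<^sub>m (n - j) *\<^sub>v vec_nth_deriv j x t)) {0..<n}"
      using ode t by blast
    then have "vec_nth_deriv n x t $ i =
        - (\<Sum>j\<in>{0..<n}. (serial_coeff n p j \<cdot>\<^sub>v (L ^\<^sub>m (n - j) *\<^sub>v vec_nth_deriv j x t)) $ i)"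
      using i finsum_vec_closed[OF closed] by (simp add: index_finsum_vec[OF _ i closed])
    also have "\<dots> = (\<Sum>j<n. companion_matrix n (serial_coeff n p) $$ (k, j) * (L *\<^sub>v serial_block n L x j t) $ i)"
      unfolding sum_negf[symmetric] atLeast0LessThan
      using True L i k by (intro sum.cong) (auto simp: L_block companion_matrix_def)
    finally show ?thesis using True n v[OF t] L by simp
  qed
  ultimately show ?thesis by simp
qed

section \<open>Decoupling and the final estimate\<close>

theorem theorem1:
  fixes N n :: nat and E :: "(nat \<times> nat) set" and W L :: "real mat"
    and p :: "nat \<Rightarrow> real" and x :: "real \<Rightarrow> real vec" and S T :: "complex mat"
  assumes graph: "weighted_adjacency_matrix N E W"
    and L: "L = graph_laplacian W"
    and n: "n \<ge> 1"
    and p_pos: "\<And>k. k \<in> {1..n} \<Longrightarrow> p k > 0"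
    and p_distinct: "\<And>i j. i \<in> {1..n} \<Longrightarrow> j \<in> {1..n} \<Longrightarrow> i \<noteq> j \<Longrightarrow> p i \<noteq> p j"
    and solution: "serial_consensus_solution N n L p x"
    and S: "S \<in> carrier_mat n n"
    and S_inverse: "T \<in> carrier_mat n n" "inverts_mat S T" "inverts_mat T S"
    and diagonalizes:
      "diagonal_mat (T * map_mat complex_of_real (companion_matrix n (serial_coeff n p)) * S)"
  shows "(SUP t\<in>{0..}. ereal (vec_norm_inf (serial_state n L x t)))
           \<le> ereal (mat_norm_inf S * mat_norm_inf T * vec_norm_inf (serial_state n L x 0))"
proof -
  let ?a = "serial_coeff n p"
  define A where "A = map_mat complex_of_real (companion_matrix n ?a)"
  define D where "D = T * A * S"
  define B where "B = vec_norm_inf (serial_state n L x 0)"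
  note T = S_inverse(1)
  have A: "A \<in> carrier_mat n n" by (simp add: A_def companion_matrix_def)
  have D: "D \<in> carrier_mat n n" using A S T by (simp add: D_def)
  have A_entry: "A $$ (k, j) = of_real (companion_matrix n ?a $$ (k, j))" if "k < n" "j < n" for k j
    using that by (simp add: A_def companion_matrix_def)
  have D_diag: "D $$ (k, j) = 0" if "k < n" "j < n" "k \<noteq> j" for k j
    using diagonalizes that D by (auto simp: diagonal_mat_def D_def[unfolded A_def, symmetric])
  have ST: "S * T = 1\<^sub>m n" and TS: "T * S = 1\<^sub>m n"
    using S_inverse S by (auto simp: inverts_mat_def)
  \<comment> \<open>Rows of \<open>T\<close> are left eigenvectors of \<open>A\<close> and decouple
    the dynamics; columns of \<open>S\<close> are right eigenvectors and locate the
    eigenvalues.\<close>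
  have TA: "T * A = D * T"
  proof -
    have "D * T = T * A * (S * T)"
      unfolding D_def by (rule assoc_mult_mat) (use A S T in auto)
    then show ?thesis using A T ST by simp
  qed
  have AS: "A * S = S * D"
  proof -
    have "S * D = S * (T * (A * S))"
      using A S T by (simp add: D_def assoc_mult_mat[of T n n A n S n])
    also have "\<dots> = (S * T) * (A * S)"
      by (rule assoc_mult_mat[symmetric]) (use A S T in auto)
    finally show ?thesis using A S ST by simp
  qed
  have mult_entry: "(P * Q) $$ (k, j) = (\<Sum>l<n. P $$ (k, l) * Q $$ (l, j))"
    if "P \<in> carrier_mat n n" "Q \<in> carrier_mat n n" "k < n" "j < n" for P Q :: "complex mat" and k j
    using that by (auto simp: scalar_prod_def atLeast0LessThan intro!: sum.cong)
  have TA_entry: "(\<Sum>l<n. T $$ (m, l) * A $$ (l, j)) = D $$ (m, m) * T $$ (m, j)"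
    if "m < n" "j < n" for m j
  proof -
    have "(\<Sum>l<n. T $$ (m, l) * A $$ (l, j)) = (\<Sum>l<n. D $$ (m, l) * T $$ (l, j))"
      using arg_cong[OF TA, of "\<lambda>M. M $$ (m, j)"] mult_entry[OF T A that] mult_entry[OF D T that] by simp
    also have "\<dots> = (\<Sum>l<n. if l = m then D $$ (m, m) * T $$ (l, j) else 0)"
      using that by (intro sum.cong) (auto simp: D_diag)
    finally show ?thesis using that by simp
  qed
  have AS_entry: "(\<Sum>l<n. A $$ (k, l) * S $$ (l, m)) = D $$ (m, m) * S $$ (k, m)"
    if "m < n" "k < n" for m k
  proof -
    have "(\<Sum>l<n. A $$ (k, l) * S $$ (l, m)) = (\<Sum>l<n. S $$ (k, l) * D $$ (l, m))"
      using arg_cong[OF AS, of "\<lambda>M. M $$ (k, m)"] mult_entry[OF A S] mult_entry[OF S D] that by simp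
    also have "\<dots> = (\<Sum>l<n. if l = m then D $$ (m, m) * S $$ (k, l) else 0)"
      using that by (intro sum.cong) (auto simp: D_diag)
    finally show ?thesis using that by simp
  qed
  have eigenvalue: "\<exists>q>0. D $$ (m, m) = - complex_of_real q" if m: "m < n" for m
  proof -
    \<comment> \<open>An eigenvector must be nonzero; a zero column of \<open>S\<close> would
      contradict \<open>T * S = 1\<^sub>m n\<close>.\<close>
    have "\<exists>k<n. S $$ (k, m) \<noteq> 0"
    proof (rule ccontr)
      assume "\<not> ?thesis"
      then have "(T * S) $$ (m, m) = 0" using mult_entry[OF T S m m] by simp
      then show False using TS m by simp
    qed
    then have "(\<Sum>j<n. of_real (?a j) * D $$ (m, m) ^ j) + D $$ (m, m) ^ n = 0"
      using AS_entry[OF m] n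
      by (intro companion_eigenvector_root[where v = "\<lambda>k. S $$ (k, m)"]) (auto simp: A_entry)
    then obtain i where i: "i \<in> {1..n}" "of_real (p i) + D $$ (m, m) = 0"
      unfolding serial_coeff_sum by auto
    then have "D $$ (m, m) = - of_real (p i)" by (simp add: eq_neg_iff_add_eq_0 add.commute)
    then show ?thesis using p_pos[OF i(1)] by blast
  qed
  have W_nonneg: "0 \<le> W $$ (i, j)" if "i < N" "j < N" for i j
    using graph that by (auto simp: weighted_adjacency_matrix_def)
  have W: "W \<in> carrier_mat N N" using graph by (auto simp: weighted_adjacency_matrix_def)
  have L_carrier: "L \<in> carrier_mat N N" using graph_laplacian_carrier[OF W] L by simp
  \<comment> \<open>Here \<open>k\<close> numbers the block and \<open>i\<close> the vertex, so
    \<open>T\<close> mixes blocks while \<open>L\<close> mixes vertices, and the two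
    commute.\<close>
  define \<xi> where "\<xi> k i t = complex_of_real (serial_block n L x k t $ i)" for k i t
  define \<eta> where "\<eta> m i t = (\<Sum>k<n. T $$ (m, k) * \<xi> k i t)" for m i t
  have \<xi>0: "norm (\<xi> k i 0) \<le> B" if "k < n" "i < N" for k i
    using serial_block_le_vec_norm_inf[OF L_carrier that] by (simp add: \<xi>_def B_def)
  have \<xi>_deriv: "(\<xi> k i has_vector_derivative
      (\<Sum>j<n. A $$ (k, j) * (\<Sum>l<N. W $$ (i, l) *\<^sub>R (\<xi> j i t - \<xi> j l t)))) (at t within {0..})"
    if "k < n" "i < N" "0 \<le> t" for k i t
  proof -
    have eq: "complex_of_real (\<Sum>j<n. companion_matrix n ?a $$ (k, j) * (L *\<^sub>v serial_block n L x j t) $ i) =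
        (\<Sum>j<n. A $$ (k, j) * (\<Sum>l<N. W $$ (i, l) *\<^sub>R (\<xi> j i t - \<xi> j l t)))"
      unfolding L of_real_sum
      using that serial_block_carrier[OF L_carrier]
      by (intro sum.cong)
        (auto simp: graph_laplacian_mult_vec_index[OF W] A_entry \<xi>_def scaleR_conv_of_real L)
    show ?thesis
      using serial_block_deriv[OF L_carrier n solution that]
      unfolding \<xi>_def[abs_def] eq[unfolded \<xi>_def, symmetric]
        has_real_derivative_iff_has_vector_derivative
      by (rule bounded_linear.has_vector_derivative[OF bounded_linear_of_real])
  qed
  have \<eta>_bound: "norm (\<eta> m i t) \<le> mat_norm_inf T * B" if m: "m < n" and "i < N" "0 \<le> t" for m i t
  proof -
    obtain q where q: "0 < q" "D $$ (m, m) = - complex_of_real q" using eigenvalue[OF m] by blast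
    show ?thesis
    proof (rule diffusion_max_principle_complex[where z = "\<eta> m" and I = "{..<N}"
          and c = "\<lambda>i l. q * W $$ (i, l)"])
      fix i s assume i: "i \<in> {..<N}" and s: "(0::real) \<le> s"
      have "(\<eta> m i has_vector_derivative (\<Sum>k<n. T $$ (m, k) *
          (\<Sum>j<n. A $$ (k, j) * (\<Sum>l<N. W $$ (i, l) *\<^sub>R (\<xi> j i s - \<xi> j l s))))) (at s within {0..})"
        unfolding \<eta>_def[abs_def]
        using i s by (intro has_vector_derivative_sum has_vector_derivative_mult_right \<xi>_deriv) auto
      also have "(\<Sum>k<n. T $$ (m, k) *
          (\<Sum>j<n. A $$ (k, j) * (\<Sum>l<N. W $$ (i, l) *\<^sub>R (\<xi> j i s - \<xi> j l s)))) =
          (\<Sum>j<n. (\<Sum>k<n. T $$ (m, k) * A $$ (k, j)) * (\<Sum>l<N. W $$ (i, l) *\<^sub>R (\<xi> j i s - \<xi> j l s)))"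
        unfolding sum_distrib_left[of "T $$ _"] sum_distrib_right
        by (subst sum.swap) (simp add: mult.assoc)
      \<comment> \<open>Left eigenvector property of row \<open>m\<close> of
        \<open>T\<close>.\<close>
      also have "\<dots> = (\<Sum>j<n. D $$ (m, m) * T $$ (m, j) * (\<Sum>l<N. W $$ (i, l) *\<^sub>R (\<xi> j i s - \<xi> j l s)))"
        using m by (intro sum.cong) (auto simp: TA_entry)
      also have "\<dots> = (\<Sum>l<N. \<Sum>j<n. D $$ (m, m) * T $$ (m, j) * (W $$ (i, l) *\<^sub>R (\<xi> j i s - \<xi> j l s)))"
        unfolding sum_distrib_left by (rule sum.swap)
      \<comment> \<open>The sign of the eigenvalue \<open>- q\<close> reverses the Laplacian
        differences, giving a diffusion with nonnegative weights
        \<open>q * W $$ (i, l)\<close>.\<close>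
      also have "\<dots> = (\<Sum>l<N. (q * W $$ (i, l)) *\<^sub>R (\<eta> m l s - \<eta> m i s))"
        unfolding \<eta>_def sum_subtractf[symmetric] scaleR_sum_right q(2)
        by (intro sum.cong) (auto simp: scaleR_conv_of_real algebra_simps)
      finally show "(\<eta> m i has_vector_derivative
          (\<Sum>l<N. (q * W $$ (i, l)) *\<^sub>R (\<eta> m l s - \<eta> m i s))) (at s within {0..})" .
    next
      fix i assume "i \<in> {..<N}"
      then show "norm (\<eta> m i 0) \<le> mat_norm_inf T * B"
        unfolding \<eta>_def using n by (intro mult_mat_row_norm_le[OF T m] \<xi>0) auto
    qed (use that q W_nonneg in auto)
  qed
  have \<xi>_eq: "\<xi> k i t = (\<Sum>m<n. S $$ (k, m) * \<eta> m i t)" if k: "k < n" for k i t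
  proof -
    have "(\<Sum>m<n. S $$ (k, m) * \<eta> m i t) = (\<Sum>j<n. (\<Sum>m<n. S $$ (k, m) * T $$ (m, j)) * \<xi> j i t)"
      unfolding \<eta>_def sum_distrib_left sum_distrib_right
      by (subst sum.swap) (simp add: mult.assoc)
    also have "\<dots> = (\<Sum>j<n. if j = k then \<xi> j i t else 0)"
      using k ST by (intro sum.cong) (auto simp: mult_entry[OF S T, symmetric])
    finally show ?thesis using k by simp
  qed
  \<comment> \<open>The row bound for the zero vector, with 1 as a bound on its entries.\<close>
  have norm_nonneg: "0 \<le> mat_norm_inf C" if "C \<in> carrier_mat n n" for C
    using mult_mat_row_norm_le[OF that, of 0 "\<lambda>_. 0" 1] n by simp
  show ?thesis
  proof (intro SUP_least, unfold ereal_less_eq, rule vec_norm_inf_serial_state_leI[OF L_carrier])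
    show "0 \<le> mat_norm_inf S * mat_norm_inf T * vec_norm_inf (serial_state n L x 0)"
      using norm_nonneg[OF S] norm_nonneg[OF T] by (simp add: vec_norm_inf_nonneg)
  next
    fix t :: real and k i assume t: "t \<in> {0..}" and k: "k < n" and i: "i < N"
    have "norm (\<xi> k i t) \<le> mat_norm_inf S * (mat_norm_inf T * B)"
      unfolding \<xi>_eq[OF k] using n t i by (intro mult_mat_row_norm_le[OF S k] \<eta>_bound) auto
    then show "\<bar>serial_block n L x k t $ i\<bar> \<le>
        mat_norm_inf S * mat_norm_inf T * vec_norm_inf (serial_state n L x 0)"
      by (simp add: \<xi>_def B_def mult.assoc)
  qed
qed

end
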